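(* Let $G=(e_X,e_Y,R)$ and $G'=(e_{X'},e_{Y'},R')$ be Galois polarities extending posets $P$ and $P'$ respectively, and let $\psi:X\uplus Y\to X'\uplus Y'$ be a Galois-stable map. Define $h^\psi_X=\iota_{X'}^{-1}\circ\psi\circ\iota_X$, $h^\psi_Y=\iota_{Y'}^{-1}\circ\psi\circ\iota_Y$ and $h^\psi_P=\gamma'^{-1}\circ\psi\circ\gamma$, where $\iota_{X'}^{-1},\iota_{Y'}^{-1},\gamma'^{-1}$ denote partial inverses. Then: (1) $h^\psi_X:X\to X'$, $h^\psi_Y:Y\to Y'$, $h^\psi_P:P\to P'$ are well defined and are the unique maps $h_X,h_Y,h_P$ satisfying $\psi\circ\iota_X=\iota_{X'}\circ h_X$, $\psi\circ\iota_Y=\iota_{Y'}\circ h_Y$, $\psi\circ\gamma=\gamma'\circ h_P$, $h_X\circ e_X=e_{X'}\circ h_P$ and $h_Y\circ e_Y=e_{Y'}\circ h_P$; (2) $h_\psi=(h^\psi_X,h^\psi_P,h^\psi_Y)$ is a polarity morphism from $G$ to $G'$.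
   Context: For a poset $Q$, $q^\uparrow=\{r:r\ge q\}$, $q^\downarrow=\{r:r\le q\}$. An order embedding $e:P\to Q$ is a meet-extension if $q=\bigwedge e[e^{-1}(q^\uparrow)]$ for all $q$, and a join-extension if $q=\bigvee e[e^{-1}(q^\downarrow)]$ for all $q$. An extension polarity is a triple $(e_X,e_Y,R)$ where $P$ is a poset, $e_X:P\to X$, $e_Y:P\to Y$ order embeddings into disjoint posets, $R\subseteq X\times Y$. It is 3-coherent if (variables over $X,Y,P$): (C1) $x_1\le_X x_2$ and $x_2\mathrel{R}y$ imply $x_1\mathrel{R}y$; (C2) $y_1\le_Y y_2$ and $x\mathrel{R}y_1$ imply $x\mathrel{R}y_2$; (C3) $e_X(p)\mathrel{R}e_Y(p)$; (C4) $x\mathrel{R}e_Y(p)$ and $e_X(p)\mathrel{R}y$ imply $x\mathrel{R}y$; (C5) $x_1\mathrel{R}e_Y(p)$ and $e_X(p)\le_X x_2$ imply $x_1\le_X x_2$; (C6) $y_1\le_Y e_Y(p)$ and $e_X(p)\mathrel{R}y_2$ imply $y_1\le_Y y_2$; (C7) if $S\subseteq P$, $\bigwedge e_X[S]=x$ in $X$, $x\mathrel{R}y_2$, $y_1\le_Y e_Y(p)$ for all $p\in S$, then $y_1\le_Y y_2$; (C8) if $T\subseteq P$, $\bigvee e_Y[T]=y$ in $Y$, $x_1\mathrel{R}y$, $e_X(q)\le_X x_2$ for all $q\in T$, then $x_1\le_X x_2$. A Galois polarity is a 3-coherent extension polarity with $e_X$ a meet-extension and $e_Y$ a join-extension. For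 a Galois polarity, let $\preceq$ be the preorder ${\le_X}\cup{\le_Y}\cup R\cup\{(y,x)\in Y\times X:\forall p,q\in P\,(e_Y(p)\le_Y y\text{ and }x\le_X e_X(q)\Rightarrow p\le_P q)\}$ on $X\cup Y$ (this is the unique "3-preorder" of the polarity). $X\uplus Y$ is the quotient poset obtained by identifying $z_1,z_2$ when $z_1\preceq z_2\preceq z_1$; $\iota_X:X\to X\uplus Y$, $\iota_Y:Y\to X\uplus Y$ are inclusion followed by quotient (they are order embeddings); $\gamma=\iota_X\circ e_X=\iota_Y\circ e_Y$ (an order embedding). Similarly for $G'$. An order preserving map $f:A\to B$ is cut-stable if whenever $b_1\not\le b_2$ in $B$ there are $a_1\not\le a_2$ in $A$ with $f^{-1}(b_1^\uparrow)\subseteq a_1^\uparrow$ and $f^{-1}(b_2^\downarrow)\subseteq a_2^\downarrow$. A map $\psi:X\uplus Y\to X'\uplus Y'$ is Galois-stable if it is order preserving, cut-stable, and satisfies $\psi\circ\gamma[P]\subseteq\gamma'[P']$, $\psi\circ\iota_X[X]\subseteq\iota_{X'}[X']$, $\psi\circ\iota_Y[Y]\subseteq\iota_{Y'}[Y']$. A polarity morphism $h=(h_X,h_P,h_Y):G\to G'$ is a triple of order preserving maps $h_X:X\to X'$, $h_P:P\to P'$, $h_Y:Y\to Y'$ such that: (M1) $h_X\circ e_X=e_{X'}\circ h_P$ and $h_Y\circ e_Y=e_{Y'}\circ h_P$; (M2) for all $x\in X,y\in Y$, $\iota_Y(y)\le\iota_X(x)$ implies $\iota_{Y'}(h_Y(y))\le\iota_{X'}(h_X(x))$;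 (M3) for all $x'\in X'$, $y'\in Y'$ with $(x',y')\notin R'$ there are $x\in X$, $y\in Y$ such that (i) $h_X^{-1}(x'^\uparrow)\subseteq x^\uparrow$, (ii) $h_Y^{-1}(y'^\downarrow)\subseteq y^\downarrow$, (iii) $h_X(a)\mathrel{R'}y'\Rightarrow a\mathrel{R}y$ for all $a\in X$, (iv) $x'\mathrel{R'}h_Y(b)\Rightarrow x\mathrel{R}b$ for all $b\in Y$, (v) $(x,y)\notin R$. *)

theory Defs
  imports Main
begin

text \<open>
  A poset is represented by its reflexive order relation \<open>r\<close> with \<^term>\<open>Partial_order r\<close>; its
  carrier is \<^term>\<open>Field r\<close>, and may be empty. A map between posets is a HOL function of which only
  the values on the carrier matter. For a poset \<open>r\<close> the principal upset and downset of \<open>q\<close> are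
  \<^term>\<open>above r q\<close> and \<^term>\<open>under r q\<close>, and \<^term>\<open>compat r s f\<close> says that \<open>f\<close> maps
  \<^term>\<open>Field r\<close> into \<^term>\<open>Field s\<close> and preserves the order.
\<close>

definition is_meet :: "'a rel \<Rightarrow> 'a set \<Rightarrow> 'a \<Rightarrow> bool" where
  "is_meet r A q \<longleftrightarrow> q \<in> Under r A \<and> (\<forall>b \<in> Under r A. (b, q) \<in> r)"

definition is_join :: "'a rel \<Rightarrow> 'a set \<Rightarrow> 'a \<Rightarrow> bool" where
  "is_join r A q \<longleftrightarrow> q \<in> Above r A \<and> (\<forall>b \<in> Above r A. (q, b) \<in> r)"

definition order_embedding :: "'a rel \<Rightarrow> 'b rel \<Rightarrow> ('a \<Rightarrow> 'b) \<Rightarrow> bool" where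
  "order_embedding r s e \<longleftrightarrow>
     e ` Field r \<subseteq> Field s \<and> (\<forall>a \<in> Field r. \<forall>b \<in> Field r. (a, b) \<in> r \<longleftrightarrow> (e a, e b) \<in> s)"

definition meet_extension :: "'a rel \<Rightarrow> 'b rel \<Rightarrow> ('a \<Rightarrow> 'b) \<Rightarrow> bool" where
  "meet_extension r s e \<longleftrightarrow> order_embedding r s e \<and>
     (\<forall>q \<in> Field s. is_meet s (e ` (e -` above s q \<inter> Field r)) q)"

definition join_extension :: "'a rel \<Rightarrow> 'b rel \<Rightarrow> ('a \<Rightarrow> 'b) \<Rightarrow> bool" where
  "join_extension r s e \<longleftrightarrow> order_embedding r s e \<and>
     (\<forall>q \<in> Field s. is_join s (e ` (e -` under s q \<inter> Field r)) q)"

definition cut_stable :: "'a rel \<Rightarrow> 'b rel \<Rightarrow> ('a \<Rightarrow> 'b) \<Rightarrow> bool" where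
  "cut_stable r s f \<longleftrightarrow> compat r s f \<and>
     (\<forall>b1 \<in> Field s. \<forall>b2 \<in> Field s. (b1, b2) \<notin> s \<longrightarrow>
       (\<exists>a1 \<in> Field r. \<exists>a2 \<in> Field r. (a1, a2) \<notin> r \<and>
          f -` above s b1 \<inter> Field r \<subseteq> above r a1 \<and>
          f -` under s b2 \<inter> Field r \<subseteq> under r a2))"

text \<open>
  The posets \<open>X\<close> and \<open>Y\<close> are disjoint subsets of one type, so that the union \<open>X \<union> Y\<close> and the
  relations on it can be written literally. This loses no generality: take a sum type.
\<close>

record ('p, 'z) polarity =
  ordP :: "'p rel"
  ordX :: "'z rel"
  ordY :: "'z rel"
  eX :: "'p \<Rightarrow> 'z"
  eY :: "'p \<Rightarrow> 'z"
  R :: "('z \<times> 'z) set"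

abbreviation carP :: "('p, 'z) polarity \<Rightarrow> 'p set" where "carP G \<equiv> Field (ordP G)"
abbreviation carX :: "('p, 'z) polarity \<Rightarrow> 'z set" where "carX G \<equiv> Field (ordX G)"
abbreviation carY :: "('p, 'z) polarity \<Rightarrow> 'z set" where "carY G \<equiv> Field (ordY G)"

definition extension_polarity :: "('p, 'z) polarity \<Rightarrow> bool" where
  "extension_polarity G \<longleftrightarrow>
     Partial_order (ordP G) \<and> Partial_order (ordX G) \<and> Partial_order (ordY G) \<and>
     carX G \<inter> carY G = {} \<and>
     order_embedding (ordP G) (ordX G) (eX G) \<and>
     order_embedding (ordP G) (ordY G) (eY G) \<and>
     R G \<subseteq> carX G \<times> carY G"

text \<open>
  In the conditions below a variable is bounded explicitly only where its carrier does not follow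
  from the other hypotheses; the bounds on \<open>y1\<close> and \<open>x2\<close> in the last two matter for empty sets.
\<close>

definition coherent3 :: "('p, 'z) polarity \<Rightarrow> bool" where
  "coherent3 G \<longleftrightarrow>
     (\<forall>x1 x2 y. (x1, x2) \<in> ordX G \<and> (x2, y) \<in> R G \<longrightarrow> (x1, y) \<in> R G) \<and>
     (\<forall>y1 y2 x. (y1, y2) \<in> ordY G \<and> (x, y1) \<in> R G \<longrightarrow> (x, y2) \<in> R G) \<and>
     (\<forall>p \<in> carP G. (eX G p, eY G p) \<in> R G) \<and>
     (\<forall>p \<in> carP G. \<forall>x y. (x, eY G p) \<in> R G \<and> (eX G p, y) \<in> R G \<longrightarrow> (x, y) \<in> R G) \<and>
     (\<forall>p \<in> carP G. \<forall>x1 x2. (x1, eY G p) \<in> R G \<and> (eX G p, x2) \<in> ordX G \<longrightarrow> (x1, x2) \<in> ordX G) \<and>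
     (\<forall>p \<in> carP G. \<forall>y1 y2. (y1, eY G p) \<in> ordY G \<and> (eX G p, y2) \<in> R G \<longrightarrow> (y1, y2) \<in> ordY G) \<and>
     (\<forall>S x y2. \<forall>y1 \<in> carY G. S \<subseteq> carP G \<and> is_meet (ordX G) (eX G ` S) x \<and> (x, y2) \<in> R G \<and>
        (\<forall>p \<in> S. (y1, eY G p) \<in> ordY G) \<longrightarrow> (y1, y2) \<in> ordY G) \<and>
     (\<forall>T y x1. \<forall>x2 \<in> carX G. T \<subseteq> carP G \<and> is_join (ordY G) (eY G ` T) y \<and> (x1, y) \<in> R G \<and>
        (\<forall>q \<in> T. (eX G q, x2) \<in> ordX G) \<longrightarrow> (x1, x2) \<in> ordX G)"

definition galois_polarity :: "('p, 'z) polarity \<Rightarrow> bool" where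
  "galois_polarity G \<longleftrightarrow> extension_polarity G \<and> coherent3 G \<and>
     meet_extension (ordP G) (ordX G) (eX G) \<and> join_extension (ordP G) (ordY G) (eY G)"

definition pre :: "('p, 'z) polarity \<Rightarrow> 'z rel" where
  "pre G = ordX G \<union> ordY G \<union> R G \<union>
     {(y, x) \<in> carY G \<times> carX G. \<forall>p \<in> carP G. \<forall>q \<in> carP G.
        (eY G p, y) \<in> ordY G \<and> (x, eX G q) \<in> ordX G \<longrightarrow> (p, q) \<in> ordP G}"

text \<open>
  \<open>iota G\<close> sends \<open>z \<in> X \<union> Y\<close> to its equivalence class under \<open>pre G\<close>. It thus serves as
  both \<open>\<iota>\<^sub>X\<close> and \<open>\<iota>\<^sub>Y\<close>, which are its restrictions to \<open>X\<close> and to \<open>Y\<close>.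
\<close>

definition iota :: "('p, 'z) polarity \<Rightarrow> 'z \<Rightarrow> 'z set" where
  "iota G z = (pre G \<inter> (pre G)\<inverse>) `` {z}"

definition quot_order :: "('p, 'z) polarity \<Rightarrow> 'z set rel" where
  "quot_order G = {(iota G z, iota G w) | z w. (z, w) \<in> pre G}"

definition gamma :: "('p, 'z) polarity \<Rightarrow> 'p \<Rightarrow> 'z set" where
  "gamma G = iota G \<circ> eX G"

definition galois_stable ::
  "('p, 'z) polarity \<Rightarrow> ('q, 'w) polarity \<Rightarrow> ('z set \<Rightarrow> 'w set) \<Rightarrow> bool" where
  "galois_stable G G' \<psi> \<longleftrightarrow>
     compat (quot_order G) (quot_order G') \<psi> \<and>
     cut_stable (quot_order G) (quot_order G') \<psi> \<and>
     (\<psi> \<circ> gamma G) ` carP G \<subseteq> gamma G' ` carP G' \<and>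
     (\<psi> \<circ> iota G) ` carX G \<subseteq> iota G' ` carX G' \<and>
     (\<psi> \<circ> iota G) ` carY G \<subseteq> iota G' ` carY G'"

definition polarity_morphism ::
  "('p, 'z) polarity \<Rightarrow> ('q, 'w) polarity \<Rightarrow> ('z \<Rightarrow> 'w) \<Rightarrow> ('p \<Rightarrow> 'q) \<Rightarrow> ('z \<Rightarrow> 'w) \<Rightarrow> bool" where
  "polarity_morphism G G' hX hP hY \<longleftrightarrow>
     compat (ordX G) (ordX G') hX \<and> compat (ordP G) (ordP G') hP \<and> compat (ordY G) (ordY G') hY \<and>
     (\<forall>p \<in> carP G. hX (eX G p) = eX G' (hP p)) \<and>
     (\<forall>p \<in> carP G. hY (eY G p) = eY G' (hP p)) \<and>
     (\<forall>x \<in> carX G. \<forall>y \<in> carY G. (iota G y, iota G x) \<in> quot_order G \<longrightarrow>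
        (iota G' (hY y), iota G' (hX x)) \<in> quot_order G') \<and>
     (\<forall>x' \<in> carX G'. \<forall>y' \<in> carY G'. (x', y') \<notin> R G' \<longrightarrow>
        (\<exists>x \<in> carX G. \<exists>y \<in> carY G.
           hX -` above (ordX G') x' \<inter> carX G \<subseteq> above (ordX G) x \<and>
           hY -` under (ordY G') y' \<inter> carY G \<subseteq> under (ordY G) y \<and>
           (\<forall>a \<in> carX G. (hX a, y') \<in> R G' \<longrightarrow> (a, y) \<in> R G) \<and>
           (\<forall>b \<in> carY G. (x', hY b) \<in> R G' \<longrightarrow> (x, b) \<in> R G) \<and>
           (x, y) \<notin> R G))"

text \<open>
  \<^const>\<open>inv_into\<close> renders the partial inverses below; it is arbitrary outside the image, so the
  well-definedness of these maps has to be asserted separately.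
\<close>

definition indX ::
  "('p, 'z) polarity \<Rightarrow> ('q, 'w) polarity \<Rightarrow> ('z set \<Rightarrow> 'w set) \<Rightarrow> 'z \<Rightarrow> 'w" where
  "indX G G' \<psi> = inv_into (carX G') (iota G') \<circ> \<psi> \<circ> iota G"

definition indY ::
  "('p, 'z) polarity \<Rightarrow> ('q, 'w) polarity \<Rightarrow> ('z set \<Rightarrow> 'w set) \<Rightarrow> 'z \<Rightarrow> 'w" where
  "indY G G' \<psi> = inv_into (carY G') (iota G') \<circ> \<psi> \<circ> iota G"

definition indP ::
  "('p, 'z) polarity \<Rightarrow> ('q, 'w) polarity \<Rightarrow> ('z set \<Rightarrow> 'w set) \<Rightarrow> 'p \<Rightarrow> 'q" where
  "indP G G' \<psi> = inv_into (carP G') (gamma G') \<circ> \<psi> \<circ> gamma G"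

definition lifting_maps ::
  "('p, 'z) polarity \<Rightarrow> ('q, 'w) polarity \<Rightarrow> ('z set \<Rightarrow> 'w set) \<Rightarrow>
     ('z \<Rightarrow> 'w) \<Rightarrow> ('p \<Rightarrow> 'q) \<Rightarrow> ('z \<Rightarrow> 'w) \<Rightarrow> bool" where
  "lifting_maps G G' \<psi> hX hP hY \<longleftrightarrow>
     hX ` carX G \<subseteq> carX G' \<and> hP ` carP G \<subseteq> carP G' \<and> hY ` carY G \<subseteq> carY G' \<and>
     (\<forall>x \<in> carX G. \<psi> (iota G x) = iota G' (hX x)) \<and>
     (\<forall>y \<in> carY G. \<psi> (iota G y) = iota G' (hY y)) \<and>
     (\<forall>p \<in> carP G. \<psi> (gamma G p) = gamma G' (hP p)) \<and>
     (\<forall>p \<in> carP G. hX (eX G p) = eX G' (hP p)) \<and>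
     (\<forall>p \<in> carP G. hY (eY G p) = eY G' (hP p))"

end

theory Submission
  imports Defs
begin

text \<open>
  The coherence conditions make \<open>pre G\<close> a preorder which restricts to the given relations on
  \<open>X\<close>, on \<open>Y\<close> and on \<open>X \<times> Y\<close>, so all three maps into the quotient are
  order embeddings and part (1) as well as (M1) and (M2) are formal. For (M3), cut-stability yields
  \<open>a\<^sub>1 \<not>\<le> a\<^sub>2\<close> in \<open>X \<uplus> Y\<close>; since every element is a join of elements of \<open>X\<close> and a meet of
  elements of \<open>Y\<close>, the pair can be replaced by some \<open>x \<le> a\<^sub>1\<close> in \<open>X\<close> and \<open>y \<ge> a\<^sub>2\<close> in \<open>Y\<close> with
  \<open>x \<not>\<le> y\<close>, and these serve as witnesses.
\<close>

section \<open>Order axioms in pointwise form\<close>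

lemma Partial_order_refl: "Partial_order r \<Longrightarrow> a \<in> Field r \<Longrightarrow> (a, a) \<in> r"
  by (simp add: partial_order_on_def preorder_on_def refl_on_def)

lemma Partial_order_trans: "Partial_order r \<Longrightarrow> (a, b) \<in> r \<Longrightarrow> (b, c) \<in> r \<Longrightarrow> (a, c) \<in> r"
  by (auto simp: partial_order_on_def preorder_on_def dest: transD)

lemma Partial_order_antisym: "Partial_order r \<Longrightarrow> (a, b) \<in> r \<Longrightarrow> (b, a) \<in> r \<Longrightarrow> a = b"
  by (auto simp: partial_order_on_def dest: antisymD)

section \<open>Embeddings and coherence conditions of a Galois polarity\<close>

locale galois =
  fixes G :: "('p, 'z) polarity"
  assumes galois: "galois_polarity G"
begin

lemma ext: "extension_polarity G" and coh: "coherent3 G"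
  and meet_ext: "meet_extension (ordP G) (ordX G) (eX G)"
  and join_ext: "join_extension (ordP G) (ordY G) (eY G)"
  using galois by (auto simp: galois_polarity_def)

lemma order_P: "Partial_order (ordP G)"
  and order_X: "Partial_order (ordX G)"
  and order_Y: "Partial_order (ordY G)"
  and disjoint: "carX G \<inter> carY G = {}"
  and R_subset: "R G \<subseteq> carX G \<times> carY G"
  using ext by (auto simp: extension_polarity_def)

lemma eX_in: "p \<in> carP G \<Longrightarrow> eX G p \<in> carX G"
  and eY_in: "p \<in> carP G \<Longrightarrow> eY G p \<in> carY G"
  and eX_le_iff: "p \<in> carP G \<Longrightarrow> q \<in> carP G \<Longrightarrow> (eX G p, eX G q) \<in> ordX G \<longleftrightarrow> (p, q) \<in> ordP G"
  and eY_le_iff: "p \<in> carP G \<Longrightarrow> q \<in> carP G \<Longrightarrow> (eY G p, eY G q) \<in> ordY G \<longleftrightarrow> (p, q) \<in> ordP G"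
  using ext unfolding extension_polarity_def order_embedding_def by blast+

lemma C1: "(x1, x2) \<in> ordX G \<Longrightarrow> (x2, y) \<in> R G \<Longrightarrow> (x1, y) \<in> R G"
  using coh unfolding coherent3_def by (elim conjE) blast

lemma C2: "(y1, y2) \<in> ordY G \<Longrightarrow> (x, y1) \<in> R G \<Longrightarrow> (x, y2) \<in> R G"
  using coh unfolding coherent3_def by (elim conjE) blast

lemma C3: "p \<in> carP G \<Longrightarrow> (eX G p, eY G p) \<in> R G"
  using coh unfolding coherent3_def by (elim conjE) blast

lemma C5: "p \<in> carP G \<Longrightarrow> (x1, eY G p) \<in> R G \<Longrightarrow> (eX G p, x2) \<in> ordX G \<Longrightarrow> (x1, x2) \<in> ordX G"
  using coh unfolding coherent3_def by (elim conjE) blast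

lemma C6: "p \<in> carP G \<Longrightarrow> (y1, eY G p) \<in> ordY G \<Longrightarrow> (eX G p, y2) \<in> R G \<Longrightarrow> (y1, y2) \<in> ordY G"
  using coh unfolding coherent3_def by (elim conjE) blast

lemma C7:
  assumes "S \<subseteq> carP G" "is_meet (ordX G) (eX G ` S) x" "(x, y2) \<in> R G" "y1 \<in> carY G"
    and "\<forall>p \<in> S. (y1, eY G p) \<in> ordY G"
  shows "(y1, y2) \<in> ordY G"
proof -
  have "\<forall>S x y2. \<forall>y1 \<in> carY G. S \<subseteq> carP G \<and> is_meet (ordX G) (eX G ` S) x \<and> (x, y2) \<in> R G \<and>
      (\<forall>p \<in> S. (y1, eY G p) \<in> ordY G) \<longrightarrow> (y1, y2) \<in> ordY G"
    using coh unfolding coherent3_def by (elim conjE)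
  with assms show ?thesis by metis
qed

lemma C8:
  assumes "T \<subseteq> carP G" "is_join (ordY G) (eY G ` T) y" "(x1, y) \<in> R G" "x2 \<in> carX G"
    and "\<forall>q \<in> T. (eX G q, x2) \<in> ordX G"
  shows "(x1, x2) \<in> ordX G"
proof -
  have "\<forall>T y x1. \<forall>x2 \<in> carX G. T \<subseteq> carP G \<and> is_join (ordY G) (eY G ` T) y \<and> (x1, y) \<in> R G \<and>
      (\<forall>q \<in> T. (eX G q, x2) \<in> ordX G) \<longrightarrow> (x1, x2) \<in> ordX G"
    using coh unfolding coherent3_def by (elim conjE)
  with assms show ?thesis by metis
qed

text \<open>Left to right is \<open>C5\<close> with \<open>x2 = eX G p\<close>; right to left
  combines \<open>C1\<close> with \<open>C3\<close>. Together with its dual it lets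
  \<open>eX G p\<close> and \<open>eY G p\<close> act as one element.\<close>

lemma R_eY_iff:
  assumes "p \<in> carP G"
  shows "(x, eY G p) \<in> R G \<longleftrightarrow> (x, eX G p) \<in> ordX G"
  using assms C1 C3 C5 eX_in Partial_order_refl[OF order_X] by blast

lemma R_eX_iff:
  assumes "p \<in> carP G"
  shows "(eX G p, y) \<in> R G \<longleftrightarrow> (eY G p, y) \<in> ordY G"
  using assms C2 C3 C6 eY_in Partial_order_refl[OF order_Y] by blast

section \<open>Density of \<open>P\<close> in \<open>X\<close> and in \<open>Y\<close>\<close>

lemma is_meet_upset:
  "x \<in> carX G \<Longrightarrow> is_meet (ordX G) (eX G ` {p \<in> carP G. (x, eX G p) \<in> ordX G}) x"
  using meet_ext
  by (auto simp: meet_extension_def above_def vimage_def Int_def conj_commute)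

lemma is_join_downset:
  "y \<in> carY G \<Longrightarrow> is_join (ordY G) (eY G ` {p \<in> carP G. (eY G p, y) \<in> ordY G}) y"
  using join_ext
  by (auto simp: join_extension_def under_def vimage_def Int_def conj_commute)

text \<open>\<open>x2\<close> is the meet of the images of \<open>P\<close> above it, and
  \<open>x1\<close> is a lower bound of these. That \<open>x1\<close> lies in the carrier matters
  when there are none.\<close>

lemma le_X_if:
  assumes "x1 \<in> carX G" "x2 \<in> carX G"
    and "\<And>q. q \<in> carP G \<Longrightarrow> (x2, eX G q) \<in> ordX G \<Longrightarrow> (x1, eX G q) \<in> ordX G"
  shows "(x1, x2) \<in> ordX G"
  using is_meet_upset[OF assms(2)] assms(1,3) by (auto simp: is_meet_def Under_def)

lemma le_Y_if:
  assumes "y1 \<in> carY G" "y2 \<in> carY G"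
    and "\<And>p. p \<in> carP G \<Longrightarrow> (eY G p, y1) \<in> ordY G \<Longrightarrow> (eY G p, y2) \<in> ordY G"
  shows "(y1, y2) \<in> ordY G"
  using is_join_downset[OF assms(1)] assms(2,3) by (auto simp: is_join_def Above_def)

section \<open>The preorder on the union of \<open>X\<close> and \<open>Y\<close>\<close>

lemma pre_XX: "x1 \<in> carX G \<Longrightarrow> x2 \<in> carX G \<Longrightarrow> (x1, x2) \<in> pre G \<longleftrightarrow> (x1, x2) \<in> ordX G"
  and pre_YY: "y1 \<in> carY G \<Longrightarrow> y2 \<in> carY G \<Longrightarrow> (y1, y2) \<in> pre G \<longleftrightarrow> (y1, y2) \<in> ordY G"
  and pre_XY: "x1 \<in> carX G \<Longrightarrow> y1 \<in> carY G \<Longrightarrow> (x1, y1) \<in> pre G \<longleftrightarrow> (x1, y1) \<in> R G"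
  and pre_YX: "y1 \<in> carY G \<Longrightarrow> x1 \<in> carX G \<Longrightarrow> (y1, x1) \<in> pre G \<longleftrightarrow>
    (\<forall>p \<in> carP G. \<forall>q \<in> carP G. (eY G p, y1) \<in> ordY G \<and> (x1, eX G q) \<in> ordX G \<longrightarrow> (p, q) \<in> ordP G)"
  \<comment> \<open>The four parts of \<open>pre G\<close> live on \<open>X \<times> X\<close>,
    \<open>Y \<times> Y\<close>, \<open>X \<times> Y\<close> and \<open>Y \<times> X\<close>;
    disjointness leaves just one of them for each pair.\<close>
  using disjoint R_subset unfolding pre_def by (auto dest: FieldI1 FieldI2)

lemma pre_subset: "pre G \<subseteq> (carX G \<union> carY G) \<times> (carX G \<union> carY G)"
  using R_subset unfolding pre_def by (auto intro: FieldI1 FieldI2)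

lemma pre_refl: "z \<in> carX G \<union> carY G \<Longrightarrow> (z, z) \<in> pre G"
  using Partial_order_refl[OF order_X] Partial_order_refl[OF order_Y] by (auto simp: pre_def)

text \<open>Here \<open>C8\<close> enters: \<open>y\<close> is the join of the \<open>eY G p\<close>
  below it, and each such \<open>eX G p\<close> is below \<open>x2\<close> because \<open>p\<close>
  is below all of \<open>P\<close> above \<open>x2\<close>.\<close>

lemma pre_XYX:
  assumes "x1 \<in> carX G" "y \<in> carY G" "x2 \<in> carX G" "(x1, y) \<in> pre G" "(y, x2) \<in> pre G"
  shows "(x1, x2) \<in> pre G"
proof -
  have "(eX G p, x2) \<in> ordX G" if p: "p \<in> carP G" "(eY G p, y) \<in> ordY G" for p
  proof (rule le_X_if)
    fix q assume "q \<in> carP G" "(x2, eX G q) \<in> ordX G"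
    with p show "(eX G p, eX G q) \<in> ordX G"
      using assms(5) pre_YX[OF assms(2,3)] eX_le_iff by blast
  qed (use p assms eX_in in auto)
  moreover have "(x1, y) \<in> R G" using assms by (simp add: pre_XY)
  ultimately have "(x1, x2) \<in> ordX G"
    using C8[OF _ is_join_downset[OF assms(2)]] assms(3) by simp
  then show ?thesis using assms by (simp add: pre_XX)
qed

text \<open>Dually, \<open>x\<close> is the meet of the \<open>eX G p\<close> above it, each such
  \<open>eY G p\<close> bounds \<open>y1\<close>, and \<open>C7\<close> passes the bound on to
  \<open>y2\<close>.\<close>

lemma pre_YXY:
  assumes "y1 \<in> carY G" "x \<in> carX G" "y2 \<in> carY G" "(y1, x) \<in> pre G" "(x, y2) \<in> pre G"
  shows "(y1, y2) \<in> pre G"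
proof -
  have "(y1, eY G p) \<in> ordY G" if p: "p \<in> carP G" "(x, eX G p) \<in> ordX G" for p
  proof (rule le_Y_if)
    fix q assume "q \<in> carP G" "(eY G q, y1) \<in> ordY G"
    with p show "(eY G q, eY G p) \<in> ordY G"
      using assms(4) pre_YX[OF assms(1,2)] eY_le_iff by blast
  qed (use p assms eY_in in auto)
  moreover have "(x, y2) \<in> R G" using assms by (simp add: pre_XY)
  ultimately have "(y1, y2) \<in> ordY G"
    using C7[OF _ is_meet_upset[OF assms(2)]] assms(1) by simp
  then show ?thesis using assms by (simp add: pre_YY)
qed

text \<open>Only the alternating paths through \<open>X\<close>, \<open>Y\<close>, \<open>X\<close>
  and \<open>Y\<close>, \<open>X\<close>, \<open>Y\<close> need joins and meets; \<open>C1\<close>,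
  \<open>C2\<close> and transitivity of the two orders settle the other six.\<close>

lemma pre_trans:
  assumes "(a, b) \<in> pre G" "(b, c) \<in> pre G"
  shows "(a, c) \<in> pre G"
proof -
  have "a \<in> carX G \<union> carY G" "b \<in> carX G \<union> carY G" "c \<in> carX G \<union> carY G"
    using assms pre_subset by auto
  then consider
      "a \<in> carX G" "b \<in> carX G" "c \<in> carX G" | "a \<in> carX G" "b \<in> carX G" "c \<in> carY G"
    | "a \<in> carX G" "b \<in> carY G" "c \<in> carX G" | "a \<in> carX G" "b \<in> carY G" "c \<in> carY G"
    | "a \<in> carY G" "b \<in> carX G" "c \<in> carX G" | "a \<in> carY G" "b \<in> carX G" "c \<in> carY G"
    | "a \<in> carY G" "b \<in> carY G" "c \<in> carX G" | "a \<in> carY G" "b \<in> carY G" "c \<in> carY G"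
    by blast
  then show ?thesis
  proof cases
    case 1 then show ?thesis
      using assms Partial_order_trans[OF order_X] by (simp add: pre_XX)
  next
    case 2 then show ?thesis using assms C1 by (simp add: pre_XX pre_XY)
  next
    case 3 then show ?thesis using assms pre_XYX by blast
  next
    case 4 then show ?thesis using assms C2 by (simp add: pre_YY pre_XY)
  next
    \<comment> \<open>Elements of \<open>P\<close> above \<open>c\<close> are also above
      \<open>b\<close>, so the condition for \<open>(a, b)\<close> carries over to
      \<open>(a, c)\<close>.\<close>
    case 5 then show ?thesis
      using assms Partial_order_trans[OF order_X] by (simp add: pre_XX pre_YX)
  next
    case 6 then show ?thesis using assms pre_YXY by blast
  next
    case 7 then show ?thesis
      using assms Partial_order_trans[OF order_Y] by (simp add: pre_YY pre_YX) blast
  next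
    case 8 then show ?thesis
      using assms Partial_order_trans[OF order_Y] by (simp add: pre_YY)
  qed
qed

section \<open>The quotient and the maps into it\<close>

lemma iota_eq_iff:
  assumes "z \<in> carX G \<union> carY G" "w \<in> carX G \<union> carY G"
  shows "iota G z = iota G w \<longleftrightarrow> (z, w) \<in> pre G \<and> (w, z) \<in> pre G"
proof
  assume "iota G z = iota G w"
  \<comment> \<open>Reflexivity puts \<open>w\<close> in its own class, hence in the class of
    \<open>z\<close>.\<close>
  moreover have "w \<in> iota G w" using pre_refl[OF assms(2)] by (simp add: iota_def)
  ultimately show "(z, w) \<in> pre G \<and> (w, z) \<in> pre G" by (auto simp: iota_def)
next
  assume "(z, w) \<in> pre G \<and> (w, z) \<in> pre G"
  then show "iota G z = iota G w"
    unfolding iota_def by (blast intro: pre_trans)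
qed

text \<open>The order does not depend on representatives: the path from \<open>z\<close> through
  \<open>z'\<close> and \<open>w'\<close> to \<open>w\<close> composes in
  \<open>pre G\<close>.\<close>

lemma quot_order_iff:
  assumes "z \<in> carX G \<union> carY G" "w \<in> carX G \<union> carY G"
  shows "(iota G z, iota G w) \<in> quot_order G \<longleftrightarrow> (z, w) \<in> pre G"
proof
  assume "(iota G z, iota G w) \<in> quot_order G"
  then obtain z' w' where eq: "iota G z = iota G z'" "iota G w = iota G w'" and le: "(z', w') \<in> pre G"
    by (auto simp: quot_order_def)
  from le have "z' \<in> carX G \<union> carY G" "w' \<in> carX G \<union> carY G"
    using pre_subset by auto
  with eq assms have "(z, z') \<in> pre G" "(w', w) \<in> pre G"
    by (simp_all add: iota_eq_iff)
  with le show "(z, w) \<in> pre G" using pre_trans by blast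
next
  assume "(z, w) \<in> pre G"
  then show "(iota G z, iota G w) \<in> quot_order G" unfolding quot_order_def by blast
qed

lemma Field_quot_order: "Field (quot_order G) = iota G ` (carX G \<union> carY G)"
proof
  show "Field (quot_order G) \<subseteq> iota G ` (carX G \<union> carY G)"
    using pre_subset unfolding Field_def quot_order_def by blast
  show "iota G ` (carX G \<union> carY G) \<subseteq> Field (quot_order G)"
  proof
    fix a assume "a \<in> iota G ` (carX G \<union> carY G)"
    then have "(a, a) \<in> quot_order G" using pre_refl by (auto simp: quot_order_iff)
    then show "a \<in> Field (quot_order G)" by (rule FieldI1)
  qed
qed

text \<open>On \<open>X\<close> the preorder is the partial order \<open>ordX G\<close>, so
  antisymmetry keeps distinct elements in distinct classes.\<close>

lemma inj_on_iota_X: "inj_on (iota G) (carX G)"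
  by (rule inj_onI) (simp add: iota_eq_iff pre_XX Partial_order_antisym[OF order_X])

lemma inj_on_iota_Y: "inj_on (iota G) (carY G)"
  by (rule inj_onI) (simp add: iota_eq_iff pre_YY Partial_order_antisym[OF order_Y])

text \<open>\<open>C3\<close> puts \<open>eX G p\<close> below \<open>eY G p\<close>. Conversely,
  \<open>q \<le> p\<close> and \<open>p \<le> r\<close> yield \<open>q \<le> r\<close>, which is the
  condition on \<open>Y \<times> X\<close>.\<close>

lemma iota_eY: "p \<in> carP G \<Longrightarrow> iota G (eY G p) = gamma G p"
  using C3[of p] Partial_order_trans[OF order_P, of _ p]
  by (simp add: gamma_def iota_eq_iff eX_in eY_in pre_XY pre_YX eX_le_iff eY_le_iff)

lemma quot_order_gamma_iff:
  "p \<in> carP G \<Longrightarrow> q \<in> carP G \<Longrightarrow> (gamma G p, gamma G q) \<in> quot_order G \<longleftrightarrow> (p, q) \<in> ordP G"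
  by (simp add: gamma_def quot_order_iff eX_in pre_XX eX_le_iff)

lemma inj_on_gamma: "inj_on (gamma G) (carP G)"
proof (rule inj_onI)
  fix p q assume pq: "p \<in> carP G" "q \<in> carP G" "gamma G p = gamma G q"
  have "(gamma G p, gamma G p) \<in> quot_order G"
    using pq by (simp add: quot_order_gamma_iff Partial_order_refl[OF order_P])
  then have "(p, q) \<in> ordP G" "(q, p) \<in> ordP G"
    using pq quot_order_gamma_iff[of p q] quot_order_gamma_iff[of q p] by simp_all
  then show "p = q" by (rule Partial_order_antisym[OF order_P])
qed

section \<open>Separation by elements of \<open>X\<close> and \<open>Y\<close>\<close>

text \<open>Join-density of the image of \<open>X\<close> in the quotient, in separating
  form.\<close>

lemma separate_X:
  assumes "z \<in> carX G \<union> carY G" "w \<in> carX G \<union> carY G" "(z, w) \<notin> pre G"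
  obtains x where "x \<in> carX G" "(x, z) \<in> pre G" "(x, w) \<notin> pre G"
proof (cases "z \<in> carX G")
  case True
  then show ?thesis using that assms pre_refl by blast
next
  case False
  with assms have z: "z \<in> carY G" by blast
  \<comment> \<open>As \<open>z\<close> is the join of the images of \<open>P\<close> below it, the
    separating element is sought among the \<open>eX G p\<close> with \<open>eY G p\<close> below
    \<open>z\<close>.\<close>
  have "\<exists>p \<in> carP G. (eY G p, z) \<in> ordY G \<and> (eX G p, w) \<notin> pre G"
  proof (cases "w \<in> carX G")
    case True
    \<comment> \<open>These come from the failure of the condition on \<open>Y \<times> X\<close>;
      \<open>eX G p\<close> below \<open>w\<close> would be below \<open>eX G q\<close>, forcing
      \<open>p \<le> q\<close>.\<close>
    then obtain p q where pq: "p \<in> carP G" "q \<in> carP G" "(eY G p, z) \<in> ordY G"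
        "(w, eX G q) \<in> ordX G" "(p, q) \<notin> ordP G"
      using assms z by (auto simp: pre_YX)
    then have "(eX G p, w) \<notin> ordX G"
      using Partial_order_trans[OF order_X] eX_le_iff by blast
    with pq True show ?thesis by (auto simp: pre_XX eX_in)
  next
    case False
    with assms have w: "w \<in> carY G" by blast
    then have "(z, w) \<notin> ordY G" using assms z by (simp add: pre_YY)
    then obtain p where "p \<in> carP G" "(eY G p, z) \<in> ordY G" "(eY G p, w) \<notin> ordY G"
      using le_Y_if[OF z w] by blast
    with w show ?thesis by (auto simp: pre_XY eX_in R_eX_iff)
  qed
  then show ?thesis
    using that z by (metis R_eX_iff eX_in pre_XY)
qed

text \<open>Turns any failure of the order into a failure of \<open>R G\<close>. The witness
  \<open>y\<close> is \<open>w\<close> itself or, for \<open>w\<close> in \<open>X\<close>, some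
  \<open>eY G q\<close> with \<open>q\<close> above \<open>w\<close> but not above
  \<open>x\<close>.\<close>

lemma separate_XY:
  assumes "z \<in> carX G \<union> carY G" "w \<in> carX G \<union> carY G" "(z, w) \<notin> pre G"
  obtains x y where "x \<in> carX G" "y \<in> carY G" "(x, z) \<in> pre G" "(w, y) \<in> pre G" "(x, y) \<notin> R G"
proof -
  obtain x where x: "x \<in> carX G" "(x, z) \<in> pre G" "(x, w) \<notin> pre G"
    using separate_X[OF assms] .
  show thesis
  proof (cases "w \<in> carY G")
    case True
    then show ?thesis using that x pre_refl pre_XY by blast
  next
    case False
    with assms have w: "w \<in> carX G" by blast
    then have "(x, w) \<notin> ordX G" using x by (simp add: pre_XX)
    then obtain q where q: "q \<in> carP G" "(w, eX G q) \<in> ordX G" "(x, eX G q) \<notin> ordX G"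
      using le_X_if[OF x(1) w] by blast
    show ?thesis
      using that[of x "eY G q"] x q w by (auto simp: pre_XY eY_in R_eY_iff)
  qed
qed

end

section \<open>From a Galois-stable map to its component maps\<close>

theorem theorem7p16:
  fixes G :: "('p, 'z) polarity" and G' :: "('q, 'w) polarity" and \<psi> :: "'z set \<Rightarrow> 'w set"
  assumes "galois_polarity G" and "galois_polarity G'" and "galois_stable G G' \<psi>"
  shows
    "(\<forall>x \<in> carX G. \<exists>!x'. x' \<in> carX G' \<and> iota G' x' = \<psi> (iota G x)) \<and>
     (\<forall>y \<in> carY G. \<exists>!y'. y' \<in> carY G' \<and> iota G' y' = \<psi> (iota G y)) \<and>
     (\<forall>p \<in> carP G. \<exists>!p'. p' \<in> carP G' \<and> gamma G' p' = \<psi> (gamma G p)) \<and>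
     lifting_maps G G' \<psi> (indX G G' \<psi>) (indP G G' \<psi>) (indY G G' \<psi>) \<and>
     (\<forall>hX hP hY. lifting_maps G G' \<psi> hX hP hY \<longrightarrow>
        (\<forall>x \<in> carX G. hX x = indX G G' \<psi> x) \<and>
        (\<forall>p \<in> carP G. hP p = indP G G' \<psi> p) \<and>
        (\<forall>y \<in> carY G. hY y = indY G G' \<psi> y)) \<and>
     polarity_morphism G G' (indX G G' \<psi>) (indP G G' \<psi>) (indY G G' \<psi>)"
proof -
  interpret G: galois G by unfold_locales (fact assms(1))
  interpret G': galois G' by unfold_locales (fact assms(2))
  have mono: "(a, b) \<in> quot_order G \<Longrightarrow> (\<psi> a, \<psi> b) \<in> quot_order G'" for a b
    using assms(3) by (auto simp: galois_stable_def compat_def)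
  have imX: "\<psi> (iota G x) \<in> iota G' ` carX G'" if "x \<in> carX G" for x
    using assms(3) that by (auto simp: galois_stable_def image_subset_iff)
  have imY: "\<psi> (iota G y) \<in> iota G' ` carY G'" if "y \<in> carY G" for y
    using assms(3) that by (auto simp: galois_stable_def image_subset_iff)
  have imP: "\<psi> (gamma G p) \<in> gamma G' ` carP G'" if "p \<in> carP G" for p
    using assms(3) that by (auto simp: galois_stable_def image_subset_iff)
  let ?hX = "indX G G' \<psi>" and ?hP = "indP G G' \<psi>" and ?hY = "indY G G' \<psi>"
  \<comment> \<open>Stability puts these values in the image of \<open>iota G'\<close>, where
    \<open>inv_into\<close> is a right inverse of it.\<close>
  have hX: "?hX x \<in> carX G'" "iota G' (?hX x) = \<psi> (iota G x)" if "x \<in> carX G" for x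
    using imX[OF that] by (auto simp: indX_def inv_into_into f_inv_into_f)
  have hY: "?hY y \<in> carY G'" "iota G' (?hY y) = \<psi> (iota G y)" if "y \<in> carY G" for y
    using imY[OF that] by (auto simp: indY_def inv_into_into f_inv_into_f)
  have hP: "?hP p \<in> carP G'" "gamma G' (?hP p) = \<psi> (gamma G p)" if "p \<in> carP G" for p
    using imP[OF that] by (auto simp: indP_def inv_into_into f_inv_into_f)
  \<comment> \<open>Both sides lie in \<open>X'\<close> and have the image
    \<open>\<psi> (gamma G p)\<close> under \<open>iota G'\<close>.\<close>
  have commX: "?hX (eX G p) = eX G' (?hP p)" if "p \<in> carP G" for p
  proof (rule inj_onD[OF G'.inj_on_iota_X])
    show "iota G' (?hX (eX G p)) = iota G' (eX G' (?hP p))"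
      using hP(2)[OF that] hX(2)[OF G.eX_in[OF that]] by (simp add: gamma_def)
  qed (use that hX hP G.eX_in G'.eX_in in auto)
  have commY: "?hY (eY G p) = eY G' (?hP p)" if "p \<in> carP G" for p
  proof (rule inj_onD[OF G'.inj_on_iota_Y])
    \<comment> \<open>\<open>gamma\<close> is defined through \<open>eX\<close>;
      \<open>iota_eY\<close> gives the same value through \<open>eY\<close>.\<close>
    show "iota G' (?hY (eY G p)) = iota G' (eY G' (?hP p))"
      using that hP hY(2)[OF G.eY_in[OF that]] by (simp add: G.iota_eY G'.iota_eY)
  qed (use that hY hP G.eY_in G'.eY_in in auto)
  have lifting: "lifting_maps G G' \<psi> ?hX ?hP ?hY"
    using hX hP hY commX commY by (auto simp: lifting_maps_def)
  have unique: "(\<forall>x \<in> carX G. kX x = ?hX x) \<and> (\<forall>p \<in> carP G. kP p = ?hP p) \<and>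
      (\<forall>y \<in> carY G. kY y = ?hY y)" if "lifting_maps G G' \<psi> kX kP kY" for kX kP kY
    using that hX hP hY unfolding lifting_maps_def image_subset_iff
    by (metis G'.inj_on_iota_X G'.inj_on_iota_Y G'.inj_on_gamma inj_onD)
  \<comment> \<open>The order passes into the quotient, along \<psi>, and back to \<open>X'\<close>
    because \<open>iota G'\<close> reflects it.\<close>
  have compat_X: "compat (ordX G) (ordX G') ?hX"
    unfolding compat_def
  proof (intro allI impI)
    fix a b assume "(a, b) \<in> ordX G"
    moreover from this have "a \<in> carX G" "b \<in> carX G" by (auto intro: FieldI1 FieldI2)
    ultimately show "(?hX a, ?hX b) \<in> ordX G'"
      using mono[of "iota G a" "iota G b"] hX(1)[of a] hX(1)[of b]
      by (simp add: G.quot_order_iff G.pre_XX G'.quot_order_iff G'.pre_XX flip: hX(2))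
  qed
  have compat_Y: "compat (ordY G) (ordY G') ?hY"
    unfolding compat_def
  proof (intro allI impI)
    fix a b assume "(a, b) \<in> ordY G"
    moreover from this have "a \<in> carY G" "b \<in> carY G" by (auto intro: FieldI1 FieldI2)
    ultimately show "(?hY a, ?hY b) \<in> ordY G'"
      using mono[of "iota G a" "iota G b"] hY(1)[of a] hY(1)[of b]
      by (simp add: G.quot_order_iff G.pre_YY G'.quot_order_iff G'.pre_YY flip: hY(2))
  qed
  have compat_P: "compat (ordP G) (ordP G') ?hP"
    unfolding compat_def
  proof (intro allI impI)
    fix a b assume "(a, b) \<in> ordP G"
    moreover from this have "a \<in> carP G" "b \<in> carP G" by (auto intro: FieldI1 FieldI2)
    ultimately show "(?hP a, ?hP b) \<in> ordP G'"
      using mono[of "gamma G a" "gamma G b"] hP(1)[of a] hP(1)[of b]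
      by (simp add: G.quot_order_gamma_iff G'.quot_order_gamma_iff flip: hP(2))
  qed
  have M2: "(iota G' (?hY y), iota G' (?hX x)) \<in> quot_order G'"
    if "x \<in> carX G" "y \<in> carY G" "(iota G y, iota G x) \<in> quot_order G" for x y
    using mono[OF that(3)] hX(2)[OF that(1)] hY(2)[OF that(2)] by simp
  have M3: "\<exists>x \<in> carX G. \<exists>y \<in> carY G.
      ?hX -` above (ordX G') x' \<inter> carX G \<subseteq> above (ordX G) x \<and>
      ?hY -` under (ordY G') y' \<inter> carY G \<subseteq> under (ordY G) y \<and>
      (\<forall>a \<in> carX G. (?hX a, y') \<in> R G' \<longrightarrow> (a, y) \<in> R G) \<and>
      (\<forall>b \<in> carY G. (x', ?hY b) \<in> R G' \<longrightarrow> (x, b) \<in> R G) \<and>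
      (x, y) \<notin> R G"
    if x': "x' \<in> carX G'" and y': "y' \<in> carY G'" and notR: "(x', y') \<notin> R G'" for x' y'
  proof -
    \<comment> \<open>On \<open>X' \<times> Y'\<close> the preorder is \<open>R G'\<close>, so
      \<open>notR\<close> is a failure of the quotient order, to which cut-stability
      applies.\<close>
    have "iota G' x' \<in> Field (quot_order G')" "iota G' y' \<in> Field (quot_order G')"
      "(iota G' x', iota G' y') \<notin> quot_order G'"
      using x' y' notR by (auto simp: G'.Field_quot_order G'.quot_order_iff G'.pre_XY)
    moreover have "\<forall>b1 \<in> Field (quot_order G'). \<forall>b2 \<in> Field (quot_order G').
        (b1, b2) \<notin> quot_order G' \<longrightarrow>
        (\<exists>a1 \<in> Field (quot_order G). \<exists>a2 \<in> Field (quot_order G). (a1, a2) \<notin> quot_order G \<and>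
          \<psi> -` above (quot_order G') b1 \<inter> Field (quot_order G) \<subseteq> above (quot_order G) a1 \<and>
          \<psi> -` under (quot_order G') b2 \<inter> Field (quot_order G) \<subseteq> under (quot_order G) a2)"
      using assms(3) unfolding galois_stable_def cut_stable_def by (elim conjE)
    ultimately obtain a1 a2 where a: "a1 \<in> Field (quot_order G)" "a2 \<in> Field (quot_order G)"
        "(a1, a2) \<notin> quot_order G"
      and up: "\<psi> -` above (quot_order G') (iota G' x') \<inter> Field (quot_order G)
        \<subseteq> above (quot_order G) a1"
      and down: "\<psi> -` under (quot_order G') (iota G' y') \<inter> Field (quot_order G)
        \<subseteq> under (quot_order G) a2"
      by metis
    obtain z w where z: "z \<in> carX G \<union> carY G" "a1 = iota G z"
      and w: "w \<in> carX G \<union> carY G" "a2 = iota G w"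
      using a by (auto simp: G.Field_quot_order)
    then have "(z, w) \<notin> pre G" using a(3) G.quot_order_iff by blast
    \<comment> \<open>Moving down from \<open>a1\<close> to \<open>x\<close> and up from
      \<open>a2\<close> to \<open>y\<close> only enlarges the upset and the downset, so both
      inclusions survive.\<close>
    then obtain x y where x: "x \<in> carX G" "(x, z) \<in> pre G" and y: "y \<in> carY G" "(w, y) \<in> pre G"
      and xy: "(x, y) \<notin> R G"
      using G.separate_XY[OF z(1) w(1)] by blast
    \<comment> \<open>With \<open>c\<close> in \<open>X\<close> this gives the inclusion of upsets,
      with \<open>c\<close> in \<open>Y\<close> the clause on \<open>(x, b)\<close>.\<close>
    have up': "(x, c) \<in> pre G"
      if "c \<in> carX G \<union> carY G" "(iota G' x', \<psi> (iota G c)) \<in> quot_order G'" for c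
    proof -
      have "iota G c \<in> above (quot_order G) a1"
        using that up by (auto simp: above_def G.Field_quot_order)
      then show ?thesis
        using that z x G.quot_order_iff G.pre_trans by (auto simp: above_def)
    qed
    \<comment> \<open>With \<open>c\<close> in \<open>Y\<close> this gives the inclusion of
      downsets, with \<open>c\<close> in \<open>X\<close> the clause on
      \<open>(a, y)\<close>.\<close>
    have down': "(c, y) \<in> pre G"
      if "c \<in> carX G \<union> carY G" "(\<psi> (iota G c), iota G' y') \<in> quot_order G'" for c
    proof -
      have "iota G c \<in> under (quot_order G) a2"
        using that down by (auto simp: under_def G.Field_quot_order)
      then show ?thesis
        using that w y G.quot_order_iff G.pre_trans by (auto simp: under_def)
    qed
    have "(x, c) \<in> ordX G" if "c \<in> carX G" "(x', ?hX c) \<in> ordX G'" for c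
      using up'[of c] that x' x(1) hX(1)[OF that(1)]
      by (simp add: G.pre_XX G'.quot_order_iff G'.pre_XX flip: hX(2))
    moreover have "(c, y) \<in> ordY G" if "c \<in> carY G" "(?hY c, y') \<in> ordY G'" for c
      using down'[of c] that y' y(1) hY(1)[OF that(1)]
      by (simp add: G.pre_YY G'.quot_order_iff G'.pre_YY flip: hY(2))
    moreover have "(c, y) \<in> R G" if "c \<in> carX G" "(?hX c, y') \<in> R G'" for c
      using down'[of c] that y' y(1) hX(1)[OF that(1)]
      by (simp add: G.pre_XY G'.quot_order_iff G'.pre_XY flip: hX(2))
    moreover have "(x, c) \<in> R G" if "c \<in> carY G" "(x', ?hY c) \<in> R G'" for c
      using up'[of c] that x' x(1) hY(1)[OF that(1)]
      by (simp add: G.pre_XY G'.quot_order_iff G'.pre_XY flip: hY(2))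
    ultimately show ?thesis
      using x(1) y(1) xy by (intro bexI[of _ x] bexI[of _ y]) (auto simp: above_def under_def)
  qed
  have morphism: "polarity_morphism G G' ?hX ?hP ?hY"
    unfolding polarity_morphism_def
    by (intro conjI ballI impI compat_X compat_P compat_Y commX commY M2 M3)
  have ex_X: "\<exists>!x'. x' \<in> carX G' \<and> iota G' x' = \<psi> (iota G x)" if "x \<in> carX G" for x
    using hX[OF that] by (intro ex1I[of _ "?hX x"]) (auto intro: inj_onD[OF G'.inj_on_iota_X])
  have ex_Y: "\<exists>!y'. y' \<in> carY G' \<and> iota G' y' = \<psi> (iota G y)" if "y \<in> carY G" for y
    using hY[OF that] by (intro ex1I[of _ "?hY y"]) (auto intro: inj_onD[OF G'.inj_on_iota_Y])
  have ex_P: "\<exists>!p'. p' \<in> carP G' \<and> gamma G' p' = \<psi> (gamma G p)" if "p \<in> carP G" for p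
    using hP[OF that] by (intro ex1I[of _ "?hP p"]) (auto intro: inj_onD[OF G'.inj_on_gamma])
  show ?thesis
    using unique by (intro conjI ballI ex_X ex_Y ex_P lifting morphism) simp_all
qed

end
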